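(* Let $\Omega\subset\mathbb{R}^n$ be open and let $u\in L^1_{loc}(\Omega)$ be real-valued. Then the singular set $\Sigma_u$ can be covered by countably many $(n-1)$-dimensional Lipschitz graphs; and thus the jump set $J_u$ can also be covered by countably many $(n-1)$-dimensional Lipschitz graphs.
   Context: $B_r(x)$ is the Euclidean ball of center $x$ and radius $r$ in $\mathbb{R}^n$, and $B_1:=B_1(0)$. For $u\in L^1_{loc}(\Omega)$, $x\in\Omega$ and $r>0$ sufficiently small (depending on $x$), define $u^{x,r}\in L^1(B_1)$ by $u^{x,r}(y):=u(x+ry)$. The singular set of $u$ is $$\Sigma_u:=\{x\in\Omega:\ u^{x,r}\to v \text{ in } L^1(B_1) \text{ as } r\to 0, \text{ for some } v\in L^1(B_1) \text{ not constant}\},$$ where "not constant" means not almost everywhere equal to a constant, and the limit is the full limit as $r\to0^+$. For $a,b\in\mathbb{R}$ and $\nu\in\mathbb{S}^{n-1}$ (the unit sphere of $\mathbb{R}^n$) let $u_{a,b,\nu}(y)=a$ if $\nu\cdot y>0$ and $u_{a,b,\nu}(y)=b$ if $\nu\cdot y<0$. The jump set of $u$ is $$J_u:=\{x\in\Omega:\ u^{x,r}\to u_{a,b,\nu}\text{ in }L^1(B_1)\text{ as } r\to 0, \text{ for some } a\neq b\in\mathbb{R},\ \nu\in\mathbb{S}^{n-1}\}.$$ An $(n-1)$-dimensional Lipschitz graph in $\mathbb{R}^n$ is a set that, up to a rotation of $\mathbb{R}^n$, is the graph $\{(t,f(t)):t\in\mathbb{R}^{n-1}\}$ of a Lipschitz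 function $f:\mathbb{R}^{n-1}\to\mathbb{R}$. The covering is of the whole set, with no exceptional null set. *)

theory Defs
  imports "HOL-Analysis.Analysis"
begin

text \<open>
  Functions on an open set \<open>\<Omega>\<close> are represented by total functions whose values outside
  \<open>\<Omega>\<close> are irrelevant; likewise for functions on the unit ball.
\<close>

definition L1_loc :: "(real^'n) set \<Rightarrow> (real^'n \<Rightarrow> real) \<Rightarrow> bool" where
  "L1_loc \<Omega> u \<longleftrightarrow> (\<forall>K. compact K \<and> K \<subseteq> \<Omega> \<longrightarrow> u absolutely_integrable_on K)"

definition blowup :: "(real^'n \<Rightarrow> real) \<Rightarrow> real^'n \<Rightarrow> real \<Rightarrow> real^'n \<Rightarrow> real" where
  "blowup u x r = (\<lambda>y. u (x + r *\<^sub>R y))"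

text \<open>
  The eventual integrability of \<open>w r\<close> is part of the definition, because the Bochner integral
  of a non-integrable function is \<open>0\<close>.
\<close>

definition converges_L1_unit_ball ::
    "(real \<Rightarrow> real^'n \<Rightarrow> real) \<Rightarrow> (real^'n \<Rightarrow> real) \<Rightarrow> bool" where
  "converges_L1_unit_ball w v \<longleftrightarrow>
     v absolutely_integrable_on ball 0 1 \<and>
     (\<forall>\<^sub>F r in at_right 0. w r absolutely_integrable_on ball 0 1) \<and>
     ((\<lambda>r. LINT y:ball 0 1|lebesgue. \<bar>w r y - v y\<bar>) \<longlongrightarrow> 0) (at_right 0)"

definition ae_constant_unit_ball :: "(real^'n \<Rightarrow> real) \<Rightarrow> bool" where
  "ae_constant_unit_ball v \<longleftrightarrow> (\<exists>c. AE y in lebesgue. y \<in> ball 0 1 \<longrightarrow> v y = c)"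

definition singular_set :: "(real^'n) set \<Rightarrow> (real^'n \<Rightarrow> real) \<Rightarrow> (real^'n) set" where
  "singular_set \<Omega> u =
     {x \<in> \<Omega>. \<exists>v. converges_L1_unit_ball (blowup u x) v \<and> \<not> ae_constant_unit_ball v}"

text \<open>The value on the null set \<open>\<nu> \<bullet> y = 0\<close> is immaterial.\<close>

definition jump_function :: "real \<Rightarrow> real \<Rightarrow> real^'n \<Rightarrow> real^'n \<Rightarrow> real" where
  "jump_function a b \<nu> = (\<lambda>y. if \<nu> \<bullet> y > 0 then a else b)"

definition jump_set :: "(real^'n) set \<Rightarrow> (real^'n \<Rightarrow> real) \<Rightarrow> (real^'n) set" where
  "jump_set \<Omega> u =
     {x \<in> \<Omega>. \<exists>a b \<nu>. a \<noteq> b \<and> \<nu> \<in> sphere 0 1 \<and>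
        converges_L1_unit_ball (blowup u x) (jump_function a b \<nu>)}"

text \<open>
  The space of dimension \<open>CARD('n) - 1\<close> is realised as a coordinate hyperplane
  \<open>{t. t $ k = 0}\<close>, with the \<open>k\<close>-th coordinate as the vertical one. As the graph may be
  rotated, the choice of \<open>k\<close> is immaterial. In dimension \<open>1\<close> the hyperplane is \<open>{0}\<close>
  and the graphs are single points.
\<close>

definition lipschitz_graph :: "(real^'n) set \<Rightarrow> bool" where
  "lipschitz_graph S \<longleftrightarrow>
     (\<exists>(Q :: real^'n^'n) k (f :: real^'n \<Rightarrow> real) L.
        rotation_matrix Q \<and> L-lipschitz_on {t. t $ k = 0} f \<and>
        S = (\<lambda>p. Q *v p) ` {t + f t *\<^sub>R axis k 1 | t. t $ k = 0})"

end

theory Submission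
  imports Defs
begin

text \<open>
  Let \<open>A(x, s)\<close> denote the mean of \<open>u\<close> over the cube \<open>x + s [0,1]\<^sup>n\<close>. At a singular point \<open>x\<close> the
  means \<open>A(x, s)\<close> tend to some \<open>c\<close> as \<open>s \<rightarrow> 0\<close>. By Lebesgue differentiation the nonconstant blow-up has
  a mean different from \<open>c\<close> over some cube, so after rescaling there are \<open>z \<noteq> 0\<close> and a rational \<open>q\<close>
  such that, up to replacing \<open>u\<close> by \<open>- u\<close>, \<open>A(x, s) < q < A(x + s z', s)\<close> for all small \<open>s\<close> and all
  \<open>z'\<close> near \<open>z\<close>. Two nearby points with the same parameters cannot differ by such a vector \<open>s z'\<close>:
  the point \<open>x' = x + s z'\<close> would satisfy \<open>A(x', s) < q < A(x', s)\<close>. Hence each of countably many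
  pieces of the singular set satisfies a cone condition and lies in a Lipschitz graph.
\<close>

section \<open>Lipschitz extension and sets satisfying a cone condition\<close>

text \<open>McShane's extension: the infimum over \<open>p\<close> in \<open>X\<close> of the cones
  \<open>g p + L * dist x p\<close>. An infimum of \<open>L\<close>-Lipschitz functions is
  \<open>L\<close>-Lipschitz if finite, and on \<open>X\<close> the Lipschitz bound on
  \<open>g\<close> makes the cone with apex at the point itself the smallest.\<close>

lemma lipschitz_on_extension:
  fixes g :: "'a::metric_space \<Rightarrow> real"
  assumes "L-lipschitz_on X g"
  obtains f where "L-lipschitz_on UNIV f" "\<And>x. x \<in> X \<Longrightarrow> f x = g x"
proof (cases "X = {}")
  case True
  have "L-lipschitz_on UNIV (\<lambda>_::'a. 0::real)"
    using lipschitz_on_nonneg[OF assms] by (intro lipschitz_onI) auto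
  with True that show thesis by blast
next
  case False
  have L: "L \<ge> 0" using assms by (rule lipschitz_on_nonneg)
  have g: "\<bar>g a - g b\<bar> \<le> L * dist a b" if "a \<in> X" "b \<in> X" for a b
    using lipschitz_onD[OF assms that] by (simp add: dist_real_def)
  define f where "f x = (INF p\<in>X. g p + L * dist x p)" for x
  have bdd: "bdd_below ((\<lambda>p. g p + L * dist x p) ` X)" for x
  proof -
    \<comment> \<open>Any single point of \<open>X\<close> yields a lower bound, so the infimum is a
      genuine one.\<close>
    obtain a where a: "a \<in> X" using False by blast
    have "g a - L * dist x a \<le> g p + L * dist x p" if "p \<in> X" for p
    proof -
      have "dist a p \<le> dist x a + dist x p" by (metis dist_triangle2 dist_commute)
      then have "L * dist a p \<le> L * dist x a + L * dist x p"
        using L by (metis distrib_left mult_left_mono)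
      then show ?thesis using g[OF a that] by linarith
    qed
    then show ?thesis by (intro bdd_belowI2)
  qed
  have le: "f x \<le> f y + L * dist x y" for x y
  proof -
    have "f x - L * dist x y \<le> g p + L * dist y p" if "p \<in> X" for p
    proof -
      have "f x \<le> g p + L * dist x p"
        unfolding f_def using bdd that by (rule cINF_lower)
      moreover have "L * dist x p \<le> L * dist x y + L * dist y p"
        using L by (metis dist_triangle distrib_left mult_left_mono)
      ultimately show ?thesis by linarith
    qed
    then have "f x - L * dist x y \<le> f y"
      unfolding f_def[of y] by (intro cINF_greatest False)
    then show ?thesis by simp
  qed
  show thesis
  proof
    show "L-lipschitz_on UNIV f"
    proof (rule lipschitz_onI[OF _ L])
      fix x y show "dist (f x) (f y) \<le> L * dist x y"
        using le[of x y] le[of y x] by (simp add: dist_real_def dist_commute abs_le_iff)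
    qed
    show "f x = g x" if "x \<in> X" for x
    proof (rule antisym)
      show "f x \<le> g x"
        unfolding f_def using cINF_lower[OF bdd that, of x] by simp
      show "g x \<le> f x"
        unfolding f_def
      proof (rule cINF_greatest[OF False])
        fix p assume "p \<in> X"
        then show "g x \<le> g p + L * dist x p" using g[OF that, of p] by linarith
      qed
    qed
  qed
qed

text \<open>The sign is there for dimension 1, where the identity is the only rotation and
  \<open>e\<close> may be the negative of the axis. In higher dimensions \<open>\<sigma> = 1\<close>
  works.\<close>

lemma rotation_of_axis:
  fixes e :: "real^'n" and k :: 'n
  assumes "norm e = 1"
  obtains Q :: "real^'n^'n" and \<sigma> :: real
    where "rotation_matrix Q" "\<bar>\<sigma>\<bar> = 1" "Q *v axis k 1 = \<sigma> *\<^sub>R e"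
proof (cases "2 \<le> CARD('n)")
  case True
  then obtain Q where "rotation_matrix Q" "Q *v axis k 1 = e"
    using rotation_matrix_exists_basis[OF _ assms] by metis
  then show thesis using that[of Q 1] by simp
next
  case False
  have "CARD('n) > 0" by (simp add: card_gt_0_iff)
  with False have "CARD('n) = 1" by linarith
  then obtain j where "(UNIV :: 'n set) = {j}" by (auto simp: card_1_singleton_iff)
  then have k: "i = k" for i :: 'n by (metis UNIV_I singletonD)
  define \<sigma> where "\<sigma> = e $ k"
  have "e $ i = (\<sigma> *\<^sub>R axis k 1) $ i" for i using k[of i] by (simp add: \<sigma>_def)
  then have e: "e = \<sigma> *\<^sub>R axis k 1" by (simp add: vec_eq_iff)
  then have \<sigma>: "\<bar>\<sigma>\<bar> = 1" using assms by (metis norm_scaleR norm_axis_1 mult.right_neutral)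
  then have "\<sigma> * \<sigma> = 1" by (metis abs_mult_self_eq mult_1)
  then have "axis k 1 = \<sigma> *\<^sub>R e" by (subst e) simp
  then show thesis using that[of "mat 1" \<sigma>] \<sigma>
    by (simp add: rotation_matrix_def orthogonal_matrix_id)
qed

text \<open>Exchanging \<open>x\<close> and \<open>y\<close> makes the cone condition two-sided, so
  heights along \<open>e\<close> are controlled by displacements orthogonal to \<open>e\<close>.
  Thus \<open>E\<close> is a Lipschitz graph over its projection, and the height function extends to
  the whole hyperplane.\<close>

lemma cone_condition_subset_lipschitz_graph:
  fixes E :: "(real^'n) set"
  assumes e: "norm e = 1" and \<theta>: "0 \<le> \<theta>" "\<theta> < 1"
    and cone: "\<And>x y. x \<in> E \<Longrightarrow> y \<in> E \<Longrightarrow> e \<bullet> (y - x) \<le> \<theta> * norm (y - x)"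
  shows "\<exists>G. lipschitz_graph G \<and> E \<subseteq> G"
proof -
  fix k :: 'n
  obtain Q :: "real^'n^'n" and \<sigma> :: real
    where Q: "rotation_matrix Q" and \<sigma>: "\<bar>\<sigma>\<bar> = 1" and Qk: "Q *v axis k 1 = \<sigma> *\<^sub>R e"
    using rotation_of_axis[OF e] .
  have QQ: "Q ** transpose Q = mat 1" and orth: "orthogonal_transformation ((*v) Q)"
    using Q by (auto simp: rotation_matrix_def orthogonal_matrix_def orthogonal_transformation_matrix)
  define E' where "E' = {p. Q *v p \<in> E}"
  define \<pi> where "\<pi> p = p - (p $ k) *\<^sub>R axis k 1" for p :: "real^'n"
  \<comment> \<open>By Pythagoras, a height of at most \<open>\<theta>\<close> times the length is
    at most \<open>L\<close> times the horizontal displacement.\<close>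
  define L where "L = \<theta> / sqrt (1 - \<theta>\<^sup>2)"
  have \<theta>2: "\<theta>\<^sup>2 < 1" using \<theta> by (simp add: power_less_one_iff)
  then have L0: "L \<ge> 0" unfolding L_def using \<theta> by simp
  have vert: "\<bar>q $ k - p $ k\<bar> \<le> \<theta> * norm (q - p)" if "p \<in> E'" "q \<in> E'" for p q
  proof -
    have n: "norm (Q *v q - Q *v p) = norm (q - p)"
      using orth by (simp flip: matrix_vector_mult_diff_distrib add: orthogonal_transformation_norm)
    have "q $ k - p $ k = axis k 1 \<bullet> (q - p)" by (simp add: inner_axis')
    also have "\<dots> = (Q *v axis k 1) \<bullet> (Q *v (q - p))"
      using orth by (simp add: orthogonal_transformation_def)
    also have "\<dots> = \<sigma> * (e \<bullet> (Q *v q - Q *v p))" by (simp add: Qk matrix_vector_mult_diff_distrib)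
    finally have "\<bar>q $ k - p $ k\<bar> = \<bar>e \<bullet> (Q *v q - Q *v p)\<bar>" using \<sigma> by (simp add: abs_mult)
    also have "\<dots> \<le> \<theta> * norm (q - p)"
      using cone[of "Q *v p" "Q *v q"] cone[of "Q *v q" "Q *v p"] that n
      by (simp add: E'_def abs_le_iff inner_diff_right norm_minus_commute)
    finally show ?thesis .
  qed
  have horiz: "\<bar>q $ k - p $ k\<bar> \<le> L * dist (\<pi> q) (\<pi> p)" if "p \<in> E'" "q \<in> E'" for p q
  proof -
    define s where "s = q $ k - p $ k"
    define t where "t = \<pi> q - \<pi> p"
    have qp: "q - p = t + s *\<^sub>R axis k 1" by (simp add: t_def s_def \<pi>_def algebra_simps)
    have "t $ k = 0" by (simp add: t_def \<pi>_def)
    then have "(norm (q - p))\<^sup>2 = (norm t)\<^sup>2 + s\<^sup>2"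
      unfolding qp by (subst norm_add_Pythagorean) (simp_all add: orthogonal_def inner_axis)
    moreover have "s\<^sup>2 \<le> (\<theta> * norm (q - p))\<^sup>2"
      using vert[OF that] by (metis abs_ge_zero power2_abs power_mono s_def)
    ultimately have "(1 - \<theta>\<^sup>2) * s\<^sup>2 \<le> \<theta>\<^sup>2 * (norm t)\<^sup>2" by (simp add: power_mult_distrib algebra_simps)
    then have "s\<^sup>2 \<le> (L * norm t)\<^sup>2"
      using \<theta>2 by (simp add: L_def power_mult_distrib power_divide field_simps)
    then have "\<bar>s\<bar> \<le> L * norm t" using L0 by (simp add: abs_le_square_iff[symmetric])
    then show ?thesis by (simp add: s_def t_def dist_norm)
  qed
  have inj: "inj_on \<pi> E'"
  proof (rule inj_onI)
    fix p q assume "p \<in> E'" "q \<in> E'" and eq: "\<pi> p = \<pi> q"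
    then have "p $ k = q $ k" using horiz[of p q] by simp
    with eq show "p = q" by (simp add: \<pi>_def)
  qed
  \<comment> \<open>The height of the unique point of \<open>E'\<close> above
    \<open>t\<close>.\<close>
  have "L-lipschitz_on (\<pi> ` E') (\<lambda>t. inv_into E' \<pi> t $ k)"
    using inj by (intro lipschitz_onI L0) (auto simp: dist_real_def intro!: horiz)
  then obtain f where f: "L-lipschitz_on UNIV f" "\<And>t. t \<in> \<pi> ` E' \<Longrightarrow> f t = inv_into E' \<pi> t $ k"
    using lipschitz_on_extension by blast
  define G where "G = (\<lambda>p. Q *v p) ` {t + f t *\<^sub>R axis k 1 | t. t $ k = 0}"
  have "lipschitz_graph G"
    unfolding lipschitz_graph_def G_def using Q lipschitz_on_subset[OF f(1)] by blast
  moreover have "E \<subseteq> G"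
  proof
    fix x assume "x \<in> E"
    define p where "p = transpose Q *v x"
    have x: "x = Q *v p" unfolding p_def matrix_vector_mul_assoc QQ by simp
    with \<open>x \<in> E\<close> have p: "p \<in> E'" by (simp add: E'_def)
    have "p = \<pi> p + f (\<pi> p) *\<^sub>R axis k 1" using p inj by (simp add: f(2)) (simp add: \<pi>_def)
    moreover have "\<pi> p $ k = 0" by (simp add: \<pi>_def)
    ultimately show "x \<in> G" unfolding G_def x by blast
  qed
  ultimately show ?thesis by blast
qed

section \<open>Means over cubes and their behaviour under blow-up\<close>

text \<open>For \<open>h > 0\<close> and \<open>f\<close> integrable there, this is the mean over
  the cube with lower corner \<open>y\<close> and side \<open>h\<close>. Pulling back to the unit
  cube turns \<open>box_mean_blowup\<close> into an identity free of integrability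
  conditions.\<close>

definition box_mean :: "('a::euclidean_space \<Rightarrow> real) \<Rightarrow> 'a \<Rightarrow> real \<Rightarrow> real" where
  "box_mean f y h = integral (cbox 0 One) (\<lambda>w. f (y + h *\<^sub>R w))"

lemma box_mean_eq:
  fixes f :: "'a::euclidean_space \<Rightarrow> real"
  assumes "f integrable_on cbox y (y + h *\<^sub>R One)" and h: "h > 0"
  shows "box_mean f y h = integral (cbox y (y + h *\<^sub>R One)) f / h ^ DIM('a)"
proof -
  have "((\<lambda>w. f (h *\<^sub>R w + y)) has_integral (integral (cbox y (y + h *\<^sub>R One)) f /\<^sub>R h ^ DIM('a)))
     (cbox ((y - y) /\<^sub>R h) ((y + h *\<^sub>R One - y) /\<^sub>R h))"
    by (rule has_integral_affinity'[OF integrable_integral[OF assms(1)] h])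
  then show ?thesis
    using h unfolding box_mean_def by (simp add: integral_unique add.commute divide_inverse_commute)
qed

lemma box_mean_uminus: "box_mean (\<lambda>y. - f y) y h = - box_mean f y h"
  by (simp add: box_mean_def)

lemma box_mean_blowup: "box_mean (blowup u x r) y h = box_mean u (x + r *\<^sub>R y) (r * h)"
  by (simp add: box_mean_def blowup_def algebra_simps)

lemma cube_subset_ball:
  fixes y :: "'a::euclidean_space"
  assumes "norm y + h * norm (One::'a) < 1" "h > 0"
  shows "cbox y (y + h *\<^sub>R One) \<subseteq> ball 0 1"
proof
  fix z assume z: "z \<in> cbox y (y + h *\<^sub>R One)"
  have "norm (z - y) \<le> norm (h *\<^sub>R One :: 'a)"
  proof (rule norm_le_componentwise)
    fix b :: 'a assume b: "b \<in> Basis"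
    then have "y \<bullet> b \<le> z \<bullet> b" "z \<bullet> b \<le> y \<bullet> b + h"
      using z by (auto simp: mem_box inner_add_left)
    then show "\<bar>(z - y) \<bullet> b\<bar> \<le> \<bar>h *\<^sub>R One \<bullet> b\<bar>" using b by (simp add: inner_diff_left)
  qed
  moreover have "norm z \<le> norm y + norm (z - y)" by (metis norm_triangle_sub)
  ultimately show "z \<in> ball 0 1" using assms by simp
qed

lemma box_mean_restrict:
  fixes v :: "'a::euclidean_space \<Rightarrow> real"
  assumes "norm y + h * norm (One::'a) < 1" "h > 0"
  shows "box_mean (\<lambda>y. if y \<in> ball 0 1 then v y else 0) y h = box_mean v y h"
  unfolding box_mean_def
proof (rule integral_cong)
  fix w :: 'a assume "w \<in> cbox 0 One"
  then have "y + h *\<^sub>R w \<in> cbox y (y + h *\<^sub>R One)" using assms(2) by (auto simp: mem_box inner_add_left)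
  then have "y + h *\<^sub>R w \<in> ball 0 1" using cube_subset_ball[OF assms] by blast
  then show "(if y + h *\<^sub>R w \<in> ball 0 1 then v (y + h *\<^sub>R w) else 0) = v (y + h *\<^sub>R w)" by simp
qed

text \<open>The bound does not depend on \<open>y\<close>: at fixed side, convergence in L1 makes
  the cube means converge uniformly in the position of the cube.\<close>

lemma box_mean_diff_le:
  fixes f g :: "'a::euclidean_space \<Rightarrow> real"
  assumes f: "f absolutely_integrable_on ball 0 1" and g: "g absolutely_integrable_on ball 0 1"
    and y: "norm y + h * norm (One::'a) < 1" and h: "h > 0"
  shows "\<bar>box_mean f y h - box_mean g y h\<bar>
    \<le> (LINT y:ball 0 1|lebesgue. \<bar>f y - g y\<bar>) / h ^ DIM('a)"
proof -
  define S where "S = cbox y (y + h *\<^sub>R One)"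
  have S: "S \<subseteq> ball 0 1" unfolding S_def using y h by (rule cube_subset_ball)
  have sub: "k absolutely_integrable_on S" if "k absolutely_integrable_on ball 0 1" for k :: "'a \<Rightarrow> real"
    using set_integrable_subset[OF that _ S] by (simp add: S_def)
  have fg: "(\<lambda>y. f y - g y) absolutely_integrable_on ball 0 1"
    using f g by (rule set_integral_diff)
  then have afg: "(\<lambda>y. \<bar>f y - g y\<bar>) absolutely_integrable_on ball 0 1"
    using set_integrable_norm[OF fg] by simp
  note int = set_lebesgue_integral_eq_integral(1)
  have "\<bar>integral S f - integral S g\<bar> = norm (integral S (\<lambda>y. f y - g y))"
    using int[OF sub[OF f]] int[OF sub[OF g]] by (simp add: integral_diff)
  also have "\<dots> \<le> integral S (\<lambda>y. \<bar>f y - g y\<bar>)"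
    by (rule integral_norm_bound_integral[OF int[OF sub[OF fg]] int[OF sub[OF afg]]]) simp
  also have "\<dots> \<le> integral (ball 0 1) (\<lambda>y. \<bar>f y - g y\<bar>)"
    by (rule integral_subset_le[OF S int[OF sub[OF afg]] int[OF afg]]) simp
  also have "\<dots> = (LINT y:ball 0 1|lebesgue. \<bar>f y - g y\<bar>)"
    using set_lebesgue_integral_eq_integral(2)[OF afg] by simp
  finally have "\<bar>integral S f - integral S g\<bar> / h ^ DIM('a)
      \<le> (LINT y:ball 0 1|lebesgue. \<bar>f y - g y\<bar>) / h ^ DIM('a)"
    using h by (simp add: divide_right_mono)
  moreover have "box_mean f y h - box_mean g y h = (integral S f - integral S g) / h ^ DIM('a)"
    using box_mean_eq[OF int[OF sub[OF f], unfolded S_def] h]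
      box_mean_eq[OF int[OF sub[OF g], unfolded S_def] h]
    by (simp add: S_def diff_divide_distrib)
  ultimately show ?thesis using h by (simp add: abs_divide)
qed

text \<open>The blow-up at scale \<open>r\<close> has over the cube of side \<open>h\<close> at the
  origin the mean of \<open>u\<close> at \<open>x\<close> with side \<open>r * h\<close>, so a
  single \<open>h\<close> already captures all small sides.\<close>

lemma tendsto_box_mean_blowup:
  assumes conv: "converges_L1_unit_ball (blowup u x) v"
    and h: "h > 0" "h * norm (One :: real^'n) < 1"
  shows "((\<lambda>s. box_mean u (x :: real^'n) s) \<longlongrightarrow> box_mean v 0 h) (at_right 0)"
proof -
  let ?D = "\<lambda>r. LINT y:ball 0 1|lebesgue. \<bar>blowup u x r y - v y\<bar>"
  have v: "v absolutely_integrable_on ball 0 1"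
    and ev: "\<forall>\<^sub>F r in at_right 0. blowup u x r absolutely_integrable_on ball 0 1"
    and D: "(?D \<longlongrightarrow> 0) (at_right 0)"
    using conv by (auto simp: converges_L1_unit_ball_def)
  have "((\<lambda>r. box_mean u x (r * h) - box_mean v 0 h) \<longlongrightarrow> 0) (at_right 0)"
  proof (rule tendsto_rabs_zero_cancel, rule tendsto_sandwich[of "\<lambda>_. 0"])
    show "\<forall>\<^sub>F r in at_right 0. \<bar>box_mean u x (r * h) - box_mean v 0 h\<bar> \<le> ?D r / h ^ DIM(real^'n)"
      using ev
    proof eventually_elim
      case (elim r)
      then show ?case using box_mean_diff_le[OF elim v, of 0 h] h by (simp add: box_mean_blowup)
    qed
    show "((\<lambda>r. ?D r / h ^ DIM(real^'n)) \<longlongrightarrow> 0) (at_right 0)"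
      using tendsto_divide[OF D tendsto_const[of "h ^ DIM(real^'n)"]] h by simp
  qed auto
  then have "((\<lambda>r. box_mean u x (r * h)) \<longlongrightarrow> box_mean v 0 h) (at_right 0)"
    by (simp add: LIM_zero_iff)
  \<comment> \<open>Multiplication by \<open>h > 0\<close> preserves the filter
    \<open>at_right 0\<close>, so \<open>s = r * h\<close> can be substituted.\<close>
  then show ?thesis
    using filtermap_times_pos_at_right[OF h(1), of 0]
      filterlim_filtermap[of "box_mean u x" "nhds (box_mean v 0 h)" "(*) h" "at_right 0"]
    by (simp add: mult.commute[of _ h])
qed

text \<open>An integral over a box depends continuously on both corners. This lets a strict
  inequality for a mean survive a small shift of the cube.\<close>

lemma isCont_box_mean:
  fixes f :: "'a::euclidean_space \<Rightarrow> real"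
  assumes f: "f integrable_on UNIV" and h: "h > 0"
  shows "isCont (\<lambda>y. box_mean f y h) y"
proof -
  have int: "f integrable_on cbox a b" for a b
    using f by (rule integrable_on_subcbox) simp
  have "isCont (\<lambda>y. integral (cbox y (y + h *\<^sub>R One)) f) y"
    unfolding continuous_at_eps_delta dist_norm
  proof (intro allI impI)
    fix e :: real assume e: "e > 0"
    \<comment> \<open>One unit of margin on each side keeps both corners inside this box when the
      cube moves by less than 1.\<close>
    define a b where "a = y - One" and "b = y + (h + 1) *\<^sub>R One"
    obtain d where d: "d > 0"
      "\<And>c' d'. \<lbrakk>c' \<in> cbox a b; d' \<in> cbox a b; norm (c' - y) \<le> d; norm (d' - (y + h *\<^sub>R One)) \<le> d\<rbrakk>
        \<Longrightarrow> norm (integral (cbox c' d') f - integral (cbox y (y + h *\<^sub>R One)) f) < e"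
    proof (rule indefinite_integral_continuous[OF int _ _ e])
      show "y \<in> cbox a b" "y + h *\<^sub>R One \<in> cbox a b"
        using h by (auto simp: a_def b_def mem_box algebra_simps)
    qed blast
    have "norm (integral (cbox z (z + h *\<^sub>R One)) f - integral (cbox y (y + h *\<^sub>R One)) f) < e"
      if z: "norm (z - y) < min d 1" for z
    proof (rule d(2))
      have "\<bar>z \<bullet> i - y \<bullet> i\<bar> < 1" if "i \<in> Basis" for i
        using Basis_le_norm[OF that, of "z - y"] z by (simp add: inner_diff_left)
      then show "z \<in> cbox a b" "z + h *\<^sub>R One \<in> cbox a b"
        using h by (auto simp: a_def b_def mem_box algebra_simps abs_less_iff less_imp_le)
          (smt (verit))+
    qed (use z in auto)
    then show "\<exists>d>0. \<forall>z. norm (z - y) < d \<longrightarrow>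
        norm (integral (cbox z (z + h *\<^sub>R One)) f - integral (cbox y (y + h *\<^sub>R One)) f) < e"
      using d(1) by (intro exI[of _ "min d 1"]) auto
  qed
  then show ?thesis using h unfolding box_mean_eq[OF int h] by (intro continuous_intros) auto
qed

text \<open>Lebesgue differentiation: at almost every \<open>y\<close> the means over shrinking
  cubes with corner \<open>y\<close> tend to \<open>v y\<close>. Excluding \<open>y = 0\<close>
  costs only a null set, and it later guarantees a nonzero direction for the cone.\<close>

lemma ae_constant_if_box_mean_constant:
  fixes v :: "real^'n \<Rightarrow> real"
  assumes v: "v absolutely_integrable_on ball 0 1"
    and c: "\<And>y h. y \<noteq> 0 \<Longrightarrow> h > 0 \<Longrightarrow> norm y + h * norm (One :: real^'n) < 1 \<Longrightarrow> box_mean v y h = c"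
  shows "ae_constant_unit_ball v"
proof -
  \<comment> \<open>Extension by zero gives integrability on every box and leaves the means over
    cubes inside the ball unchanged.\<close>
  define f where "f = (\<lambda>y. if y \<in> ball 0 1 then v y else 0)"
  have fU: "f absolutely_integrable_on UNIV"
    using v unfolding f_def by (simp only: absolutely_integrable_restrict_UNIV)
  have int: "f integrable_on cbox a b" for a b
    using set_lebesgue_integral_eq_integral(1)[OF fU] by (rule integrable_on_subcbox) simp
  obtain N where N: "negligible N"
    "\<And>x e. \<lbrakk>x \<notin> N; 0 < e\<rbrakk> \<Longrightarrow> \<exists>d>0. \<forall>h. 0 < h \<and> h < d \<longrightarrow>
        norm (integral (cbox x (x + h *\<^sub>R One)) f /\<^sub>R h ^ DIM(real^'n) - f x) < e"
    using integrable_ccontinuous_explicit[OF int] by blast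
  have "v y = c" if y: "y \<in> ball 0 1" "y \<notin> N" "y \<noteq> 0" for y
  proof (rule ccontr)
    assume "v y \<noteq> c"
    then have "0 < \<bar>c - v y\<bar>" by simp
    then obtain d where d: "d > 0"
      "\<And>h. 0 < h \<Longrightarrow> h < d \<Longrightarrow>
        norm (integral (cbox y (y + h *\<^sub>R One)) f /\<^sub>R h ^ DIM(real^'n) - f y) < \<bar>c - v y\<bar>"
      using N(2)[OF y(2)] by blast
    \<comment> \<open>The first bound gives \<open>h < d\<close>, the second keeps the cube inside
      the unit ball.\<close>
    define h where "h = min (d / 2) ((1 - norm y) / (2 * (norm (One :: real^'n) + 1)))"
    have O: "norm (One :: real^'n) \<ge> 0" by simp
    have h: "h > 0" "h < d" using d(1) y(1) O by (auto simp: h_def intro!: divide_pos_pos add_nonneg_pos)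
    have "h \<le> (1 - norm y) / (2 * (norm (One :: real^'n) + 1))" by (simp add: h_def)
    then have "h * (2 * (norm (One :: real^'n) + 1)) \<le> 1 - norm y" using O by (simp add: pos_le_divide_eq)
    then have hy: "norm y + h * norm (One :: real^'n) < 1"
      using h(1) mult_nonneg_nonneg[OF less_imp_le[OF h(1)] O] unfolding distrib_left by linarith
    have "box_mean f y h = box_mean v y h"
      unfolding f_def using hy h(1) by (rule box_mean_restrict)
    then have "integral (cbox y (y + h *\<^sub>R One)) f /\<^sub>R h ^ DIM(real^'n) = c"
      using box_mean_eq[OF int h(1)] c[OF y(3) h(1) hy] by (simp add: divide_inverse_commute)
    then show False using d(2)[OF h] y(1) by (simp add: f_def)
  qed
  moreover have "AE y in lebesgue. y \<notin> insert 0 N"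
    using N(1) by (intro AE_not_in) (simp flip: negligible_iff_null_sets)
  ultimately show ?thesis unfolding ae_constant_unit_ball_def by (intro exI[of _ c]) (auto elim: eventually_mono)
qed

section \<open>Separation sets: their cone condition, and singular points as members\<close>

text \<open>A single \<open>n\<close> bounds both the scale and the deviation from \<open>z\<close>.
  The blow-up limit does not occur, so countably many parameters can serve all singular
  points.\<close>

definition separation_set :: "('a::euclidean_space \<Rightarrow> real) \<Rightarrow> 'a \<Rightarrow> real \<Rightarrow> nat \<Rightarrow> 'a set" where
  "separation_set u z q n = {x. \<forall>s. 0 < s \<and> s < 1 / Suc n \<longrightarrow>
     box_mean u x s < q \<and> (\<forall>z'. norm (z' - z) < 1 / Suc n \<longrightarrow> q < box_mean u (x + s *\<^sub>R z') s)}"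

text \<open>The direction from \<open>x\<close> to \<open>x'\<close>, scaled to the length of
  \<open>z\<close>, must stay at distance at least \<open>1 / Suc n\<close> from \<open>z\<close>.
  The \<open>max\<close> keeps the constant nonnegative when \<open>1 / Suc n\<close> is large
  compared with \<open>norm z\<close>.\<close>

lemma separation_set_cone:
  fixes z :: "'a::euclidean_space"
  assumes z: "z \<noteq> 0" and x: "x \<in> separation_set u z q n" and x': "x' \<in> separation_set u z q n"
    and near: "norm (x' - x) < norm z / Suc n"
  shows "(z /\<^sub>R norm z) \<bullet> (x' - x) \<le> max 0 (1 - (1 / Suc n)\<^sup>2 / (2 * (norm z)\<^sup>2)) * norm (x' - x)"
proof (cases "x' = x")
  case False
  \<comment> \<open>This scale gives \<open>z'\<close> the same norm as \<open>z\<close>, and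
    \<open>near\<close> makes it less than \<open>1 / Suc n\<close>.\<close>
  define s where "s = norm (x' - x) / norm z"
  define z' where "z' = (x' - x) /\<^sub>R s"
  have s: "0 < s" "s < 1 / Suc n" using False z near by (auto simp: s_def field_simps)
  have x'eq: "x' = x + s *\<^sub>R z'" using s by (simp add: z'_def)
  have nz': "norm z' = norm z" using False z by (simp add: z'_def s_def)
  have "\<not> norm (z' - z) < 1 / Suc n"
  proof
    assume "norm (z' - z) < 1 / Suc n"
    then have "q < box_mean u (x + s *\<^sub>R z') s" using x s by (auto simp: separation_set_def)
    moreover have "box_mean u x' s < q" using x' s by (auto simp: separation_set_def)
    ultimately show False using x'eq by simp
  qed
  then have "(1 / Suc n)\<^sup>2 \<le> (norm (z' - z))\<^sup>2" by (intro power_mono) auto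
  \<comment> \<open>With equal norms, a lower bound on the distance becomes an upper bound on the
    inner product.\<close>
  also have "(norm (z' - z))\<^sup>2 = 2 * (norm z)\<^sup>2 - 2 * (z \<bullet> z')"
    using nz' dot_norm_neg[of z z'] norm_minus_commute[of z z'] by simp
  finally have zz': "z \<bullet> z' \<le> (norm z)\<^sup>2 * (1 - (1 / Suc n)\<^sup>2 / (2 * (norm z)\<^sup>2))"
    using z by (simp add: right_diff_distrib del: of_nat_Suc)
  have "(z /\<^sub>R norm z) \<bullet> (x' - x) = s * (z \<bullet> z') / norm z"
    unfolding x'eq by (simp add: divide_inverse)
  also have "\<dots> \<le> s * ((norm z)\<^sup>2 * (1 - (1 / Suc n)\<^sup>2 / (2 * (norm z)\<^sup>2))) / norm z"
    using zz' s(1) by (intro divide_right_mono mult_left_mono) auto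
  also have "\<dots> = (1 - (1 / Suc n)\<^sup>2 / (2 * (norm z)\<^sup>2)) * norm (x' - x)"
    using z by (simp add: s_def power2_eq_square)
  also have "\<dots> \<le> max 0 (1 - (1 / Suc n)\<^sup>2 / (2 * (norm z)\<^sup>2)) * norm (x' - x)"
    by (intro mult_right_mono) auto
  finally show ?thesis .
qed simp

text \<open>In the blow-up at scale \<open>r\<close>, the cube of side \<open>h\<close> at
  \<open>y\<close> is the cube of side \<open>s = r * h\<close> at
  \<open>x + s *\<^sub>R (y /\<^sub>R h)\<close>. Hence \<open>z\<close> is chosen in
  \<open>D\<close> close to \<open>y /\<^sub>R h\<close>.\<close>

lemma in_separation_set:
  fixes x :: "real^'n"
  assumes conv: "converges_L1_unit_ball (blowup u x) v"
    and c: "(box_mean u x \<longlongrightarrow> c) (at_right 0)"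
    and y: "y \<noteq> 0" "h > 0" "norm y + h * norm (One :: real^'n) < 1" and less: "c < box_mean v y h"
    and D: "\<And>U. open U \<Longrightarrow> U \<noteq> {} \<Longrightarrow> \<exists>d\<in>D. d \<in> U"
  shows "\<exists>z\<in>D - {0}. \<exists>q\<in>\<rat>. \<exists>n. x \<in> separation_set u z q n"
proof -
  let ?D = "\<lambda>r. LINT y:ball 0 1|lebesgue. \<bar>blowup u x r y - v y\<bar>"
  let ?N = "DIM(real^'n)"
  have v: "v absolutely_integrable_on ball 0 1"
    and ev: "\<forall>\<^sub>F r in at_right 0. blowup u x r absolutely_integrable_on ball 0 1"
    and D0: "(?D \<longlongrightarrow> 0) (at_right 0)"
    using conv by (auto simp: converges_L1_unit_ball_def)
  obtain q where q: "q \<in> \<rat>" "c < q" "q < box_mean v y h" using Rats_dense_in_real[OF less] by blast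
  \<comment> \<open>Half of the gap is spent on moving the cube, the other half on replacing
    \<open>v\<close> by the blow-up.\<close>
  define \<eta> where "\<eta> = (box_mean v y h - q) / 2"
  have \<eta>: "\<eta> > 0" using q by (simp add: \<eta>_def)
  obtain a1 where a1: "a1 > 0" "\<And>s. 0 < s \<Longrightarrow> s < a1 \<Longrightarrow> box_mean u x s < q"
    using order_tendstoD(2)[OF c q(2)] by (auto simp: eventually_at_right_field)
  have "((\<lambda>r. ?D r / h ^ ?N) \<longlongrightarrow> 0) (at_right 0)"
    using tendsto_divide[OF D0 tendsto_const[of "h ^ ?N"]] y by simp
  then have "\<forall>\<^sub>F r in at_right 0. ?D r / h ^ ?N < \<eta>" using \<eta> by (rule order_tendstoD)
  with ev have "\<forall>\<^sub>F r in at_right 0. blowup u x r absolutely_integrable_on ball 0 1 \<and> ?D r / h ^ ?N < \<eta>"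
    by (rule eventually_conj)
  then obtain a2 where a2: "a2 > 0" "\<And>r. 0 < r \<Longrightarrow> r < a2 \<Longrightarrow>
      blowup u x r absolutely_integrable_on ball 0 1 \<and> ?D r / h ^ ?N < \<eta>"
    by (auto simp: eventually_at_right_field)
  define f where "f = (\<lambda>y. if y \<in> ball 0 1 then v y else 0)"
  have "f integrable_on UNIV"
    unfolding f_def using set_lebesgue_integral_eq_integral(1)[OF v] by (simp only: integrable_restrict_UNIV)
  from isCont_box_mean[OF this y(2), of y] \<eta>
  obtain d where d: "d > 0" "\<And>y'. norm (y' - y) < d \<Longrightarrow> \<bar>box_mean f y' h - box_mean f y h\<bar> < \<eta>"
    unfolding continuous_at_eps_delta dist_norm real_norm_def by blast
  define \<delta> where "\<delta> = min d (1 - (norm y + h * norm (One :: real^'n)))"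
  have \<delta>: "\<delta> > 0" using d(1) y(3) by (simp add: \<delta>_def)
  have far: "q < box_mean u (x + r *\<^sub>R y') (r * h)" if r: "0 < r" "r < a2" and y': "norm (y' - y) < \<delta>" for r y'
  proof -
    have in_ball: "norm y' + h * norm (One :: real^'n) < 1"
      using y' norm_triangle_sub[of y' y] by (simp add: \<delta>_def)
    have "\<bar>box_mean v y' h - box_mean v y h\<bar> < \<eta>"
      using d(2)[of y'] y' box_mean_restrict[OF in_ball y(2), of v] box_mean_restrict[OF y(3,2), of v]
      by (simp add: f_def \<delta>_def)
    moreover have "\<bar>box_mean (blowup u x r) y' h - box_mean v y' h\<bar> < \<eta>"
      using box_mean_diff_le[OF _ v in_ball y(2), of "blowup u x r"] a2(2)[OF r] by linarith
    ultimately have "q < box_mean (blowup u x r) y' h"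
      unfolding \<eta>_def abs_less_iff by (simp add: field_simps)
    then show ?thesis by (simp add: box_mean_blowup)
  qed
  \<comment> \<open>The first bound leaves half of the tolerance \<open>\<delta> / h\<close> to
    \<open>z'\<close>; the second forces \<open>z \<noteq> 0\<close>.\<close>
  define \<rho> where "\<rho> = min (\<delta> / (2 * h)) (norm (y /\<^sub>R h))"
  have "\<rho> > 0" using \<delta> y by (simp add: \<rho>_def)
  then obtain z where z: "z \<in> D" "norm (z - y /\<^sub>R h) < \<rho>"
    using D[of "ball (y /\<^sub>R h) \<rho>"] by (auto simp: dist_norm norm_minus_commute)
  have "z \<noteq> 0" using z(2) y(2) by (auto simp: \<rho>_def)
  have "0 < min a1 (min (a2 * h) (\<delta> / (2 * h)))" using a1 a2 \<delta> y by simp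
  \<comment> \<open>The three bounds ensure, in turn, that the mean at \<open>x\<close> is below
    \<open>q\<close>, that \<open>r = s / h\<close> is below \<open>a2\<close>, and that
    \<open>z'\<close> is close enough to \<open>z\<close>.\<close>
  then obtain n where n: "1 / Suc n < min a1 (min (a2 * h) (\<delta> / (2 * h)))" using nat_approx_posE by blast
  have "q < box_mean u (x + s *\<^sub>R z') s"
    if s: "0 < s" "s < 1 / Suc n" and z': "norm (z' - z) < 1 / Suc n" for s z'
  proof -
    have "norm (z' - y /\<^sub>R h) < \<delta> / (2 * h) + \<delta> / (2 * h)"
      using norm_triangle_ineq[of "z' - z" "z - y /\<^sub>R h"] z' n z(2) by (simp add: \<rho>_def)
    also have "\<dots> = \<delta> / h" by simp
    finally have "h * norm (z' - y /\<^sub>R h) < \<delta>" using y(2) by (simp add: field_simps)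
    also have "h * norm (z' - y /\<^sub>R h) = norm (h *\<^sub>R (z' - y /\<^sub>R h))" using y(2) by simp
    also have "h *\<^sub>R (z' - y /\<^sub>R h) = h *\<^sub>R z' - y" using y(2) by (simp add: scaleR_diff_right)
    finally have "norm (h *\<^sub>R z' - y) < \<delta>" .
    moreover have "s < a2 * h" using s(2) n by linarith
    then have "0 < s / h" "s / h < a2" using s(1) y(2) by (auto simp: pos_divide_less_eq)
    ultimately have "q < box_mean u (x + (s / h) *\<^sub>R (h *\<^sub>R z')) (s / h * h)" using far by blast
    then show ?thesis using y(2) by simp
  qed
  then have "x \<in> separation_set u z q n" using a1(2) n by (auto simp: separation_set_def)
  with z(1) \<open>z \<noteq> 0\<close> q(1) show ?thesis by blast
qed

text \<open>Some cube off the origin has a \<open>v\<close>-mean different from the limit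
  \<open>c\<close> of the means at \<open>x\<close>. If that mean is smaller than \<open>c\<close>,
  passing to \<open>- u\<close> and \<open>- v\<close> reverses the inequality.\<close>

lemma nonconstant_blowup_in_separation_set:
  fixes x :: "real^'n"
  assumes conv: "converges_L1_unit_ball (blowup u x) v" and nonconst: "\<not> ae_constant_unit_ball v"
    and D: "\<And>U. open U \<Longrightarrow> U \<noteq> {} \<Longrightarrow> \<exists>d\<in>D. d \<in> U"
  shows "\<exists>z\<in>D - {0}. \<exists>q\<in>\<rat>. \<exists>n. x \<in> separation_set u z q n \<union> separation_set (\<lambda>y. - u y) z q n"
proof -
  \<comment> \<open>Any side for which the cube at the origin lies in the unit ball would
    do.\<close>
  define h0 where "h0 = 1 / (norm (One :: real^'n) + 1)"
  have O: "norm (One :: real^'n) + 1 > 0" by (simp add: add_nonneg_pos)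
  then have h0: "h0 > 0" by (simp add: h0_def)
  have "h0 * norm (One :: real^'n) + h0 = h0 * (norm (One :: real^'n) + 1)" by (simp add: distrib_left)
  also have "\<dots> = 1" using O by (simp add: h0_def)
  finally have h0': "h0 * norm (One :: real^'n) < 1" using h0 by linarith
  define c where "c = box_mean v 0 h0"
  have c: "(box_mean u x \<longlongrightarrow> c) (at_right 0)"
    unfolding c_def using conv h0 h0' by (rule tendsto_box_mean_blowup)
  obtain y h where y: "y \<noteq> 0" "h > 0" "norm y + h * norm (One :: real^'n) < 1" and neq: "box_mean v y h \<noteq> c"
    using ae_constant_if_box_mean_constant nonconst conv unfolding converges_L1_unit_ball_def by metis
  consider "c < box_mean v y h" | "- c < box_mean (\<lambda>y. - v y) y h"
    using neq by (auto simp: box_mean_uminus neq_iff)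
  then show ?thesis
  proof cases
    case 1
    from in_separation_set[OF conv c y 1 D] show ?thesis by blast
  next
    case 2
    have v: "v absolutely_integrable_on ball 0 1"
      and ev: "\<forall>\<^sub>F r in at_right 0. blowup u x r absolutely_integrable_on ball 0 1"
      and D0: "((\<lambda>r. LINT y:ball 0 1|lebesgue. \<bar>blowup u x r y - v y\<bar>) \<longlongrightarrow> 0) (at_right 0)"
      using conv by (auto simp: converges_L1_unit_ball_def)
    have neg: "(\<lambda>y. - w y) absolutely_integrable_on ball 0 1"
      if "w absolutely_integrable_on ball 0 1" for w :: "real^'n \<Rightarrow> real"
      using set_integrable_mult_right[of "-1", OF that] by simp
    have "converges_L1_unit_ball (blowup (\<lambda>y. - u y) x) (\<lambda>y. - v y)"
      unfolding converges_L1_unit_ball_def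
    proof (intro conjI neg v)
      show "\<forall>\<^sub>F r in at_right 0. blowup (\<lambda>y. - u y) x r absolutely_integrable_on ball 0 1"
        using ev by eventually_elim (simp add: blowup_def neg)
      show "((\<lambda>r. LINT y:ball 0 1|lebesgue. \<bar>blowup (\<lambda>y. - u y) x r y - - v y\<bar>) \<longlongrightarrow> 0) (at_right 0)"
        using D0 by (simp add: blowup_def abs_minus_commute)
    qed
    moreover have "(box_mean (\<lambda>y. - u y) x \<longlongrightarrow> - c) (at_right 0)"
      using tendsto_minus[OF c] unfolding box_mean_uminus[abs_def] .
    ultimately show ?thesis using in_separation_set[OF _ _ y 2 D] by blast
  qed
qed

section \<open>Jump points are singular points\<close>

lemma AE_lebesgue_ex_in_open:
  fixes U :: "'a::euclidean_space set"
  assumes "AE y in lebesgue. P y" "open U" "U \<noteq> {}"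
  obtains y where "y \<in> U" "P y"
proof -
  obtain N where N: "N \<in> null_sets lebesgue" "{y \<in> space lebesgue. \<not> P y} \<subseteq> N"
    using assms(1) unfolding eventually_ae_filter by blast
  then have "negligible N" by (simp add: negligible_iff_null_sets)
  then have "\<not> U \<subseteq> N" using open_not_negligible[OF assms(2,3)] negligible_subset by blast
  then show thesis using N(2) that by auto
qed

text \<open>Both values are taken on nonempty open subsets of the ball, which no null set can
  contain.\<close>

lemma jump_function_not_ae_constant:
  assumes ab: "a \<noteq> b" and \<nu>: "\<nu> \<in> sphere 0 1"
  shows "\<not> ae_constant_unit_ball (jump_function a b \<nu>)"
proof
  assume "ae_constant_unit_ball (jump_function a b \<nu>)"
  then obtain c where c: "AE y in lebesgue. y \<in> ball 0 1 \<longrightarrow> jump_function a b \<nu> y = c"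
    by (auto simp: ae_constant_unit_ball_def)
  have \<nu>\<nu>: "\<nu> \<bullet> \<nu> = 1" using \<nu> by (simp add: dot_square_norm)
  have op: "open (ball 0 1 \<inter> {y. 0 < \<nu> \<bullet> y})" "open (ball 0 1 \<inter> {y. \<nu> \<bullet> y < 0})"
    by (intro open_Int open_ball open_halfspace_gt open_halfspace_lt)+
  have "\<nu> /\<^sub>R 2 \<in> ball 0 1 \<inter> {y. 0 < \<nu> \<bullet> y}" "- \<nu> /\<^sub>R 2 \<in> ball 0 1 \<inter> {y. \<nu> \<bullet> y < 0}"
    using \<nu> \<nu>\<nu> by auto
  then have ne: "ball 0 1 \<inter> {y. 0 < \<nu> \<bullet> y} \<noteq> {}" "ball 0 1 \<inter> {y. \<nu> \<bullet> y < 0} \<noteq> {}" by blast+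
  obtain y where "y \<in> ball 0 1 \<inter> {y. 0 < \<nu> \<bullet> y}" "y \<in> ball 0 1 \<longrightarrow> jump_function a b \<nu> y = c"
    using AE_lebesgue_ex_in_open[OF c op(1) ne(1)] .
  moreover obtain y' where "y' \<in> ball 0 1 \<inter> {y. \<nu> \<bullet> y < 0}" "y' \<in> ball 0 1 \<longrightarrow> jump_function a b \<nu> y' = c"
    using AE_lebesgue_ex_in_open[OF c op(2) ne(2)] .
  ultimately have "a = c" "b = c" by (auto simp: jump_function_def)
  then show False using ab by simp
qed

lemma jump_set_subset_singular_set: "jump_set \<Omega> u \<subseteq> singular_set \<Omega> u"
  unfolding jump_set_def singular_set_def using jump_function_not_ae_constant by blast

section \<open>The countable cover\<close>

text \<open>The radius is half the distance below which \<open>separation_set_cone\<close> applies,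
  so every pair of points in the ball qualifies.\<close>

lemma separation_set_near_subset_lipschitz_graph:
  fixes z :: "real^'n"
  assumes z: "z \<noteq> 0"
  shows "\<exists>G. lipschitz_graph G \<and> separation_set u z q n \<inter> ball p (norm z / Suc n / 2) \<subseteq> G"
proof (rule cone_condition_subset_lipschitz_graph)
  let ?\<theta> = "max 0 (1 - (1 / Suc n)\<^sup>2 / (2 * (norm z)\<^sup>2))"
  show "norm (z /\<^sub>R norm z) = 1" using z by simp
  show "0 \<le> ?\<theta>" "?\<theta> < 1" using z by auto
  fix x y assume xy: "x \<in> separation_set u z q n \<inter> ball p (norm z / Suc n / 2)"
    "y \<in> separation_set u z q n \<inter> ball p (norm z / Suc n / 2)"
  have "norm (y - x) \<le> dist p y + dist p x" by (metis dist_norm dist_triangle3 dist_commute)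
  also have "\<dots> < norm z / Suc n / 2 + norm z / Suc n / 2" using xy by simp
  also have "\<dots> = norm z / Suc n" by (rule field_sum_of_halves)
  finally show "(z /\<^sub>R norm z) \<bullet> (y - x) \<le> ?\<theta> * norm (y - x)"
    using separation_set_cone[OF z] xy by blast
qed

theorem theorem1p2:
  fixes \<Omega> :: "(real^'n) set" and u :: "real^'n \<Rightarrow> real"
  assumes "open \<Omega>" and "L1_loc \<Omega> u"
  shows "(\<exists>\<G>. countable \<G> \<and> (\<forall>G\<in>\<G>. lipschitz_graph G) \<and> singular_set \<Omega> u \<subseteq> \<Union>\<G>) \<and>
         (\<exists>\<G>. countable \<G> \<and> (\<forall>G\<in>\<G>. lipschitz_graph G) \<and> jump_set \<Omega> u \<subseteq> \<Union>\<G>)"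
proof -
  obtain D :: "(real^'n) set" where "countable D"
    and D: "\<And>U. open U \<Longrightarrow> U \<noteq> {} \<Longrightarrow> \<exists>d\<in>D. d \<in> U"
    using countable_dense_setE by blast
  \<comment> \<open>The dense set \<open>D\<close> supplies both the directions \<open>z\<close> and
    the centres \<open>p\<close> of the localising balls.\<close>
  define I where "I = {u, \<lambda>y. - u y} \<times> (D - {0}) \<times> (\<rat> :: real set) \<times> (UNIV :: nat set) \<times> D"
  have "countable I"
    unfolding I_def using \<open>countable D\<close> countable_rat by (intro countable_SIGMA) auto
  have "\<forall>(w, z, q, n, p) \<in> I. \<exists>G. lipschitz_graph G \<and>
      separation_set w z q n \<inter> ball p (norm z / Suc n / 2) \<subseteq> G"
    using separation_set_near_subset_lipschitz_graph by (auto simp: I_def simp del: of_nat_Suc)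
  then have "\<forall>i\<in>I. \<exists>G. lipschitz_graph G \<and>
      (case i of (w, z, q, n, p) \<Rightarrow> separation_set w z q n \<inter> ball p (norm z / Suc n / 2)) \<subseteq> G"
    by (simp add: case_prod_unfold)
  from bchoice[OF this] obtain g where g: "\<forall>i\<in>I. lipschitz_graph (g i) \<and>
      (case i of (w, z, q, n, p) \<Rightarrow> separation_set w z q n \<inter> ball p (norm z / Suc n / 2)) \<subseteq> g i"
    by blast
  have "singular_set \<Omega> u \<subseteq> \<Union>(g ` I)"
  proof
    fix x assume "x \<in> singular_set \<Omega> u"
    then obtain v where v: "converges_L1_unit_ball (blowup u x) v" "\<not> ae_constant_unit_ball v"
      by (auto simp: singular_set_def)
    obtain z q n w where z: "z \<in> D - {0}" "q \<in> \<rat>" "w \<in> {u, \<lambda>y. - u y}" "x \<in> separation_set w z q n"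
      using nonconstant_blowup_in_separation_set[OF v D] by blast
    have "ball x (norm z / Suc n / 2) \<noteq> {}" using z(1) by (simp add: not_le del: of_nat_Suc)
    \<comment> \<open>The radius does not depend on the centre, so \<open>p\<close> near
      \<open>x\<close> also puts \<open>x\<close> in the ball around \<open>p\<close>.\<close>
    then obtain p where p: "p \<in> D" "p \<in> ball x (norm z / Suc n / 2)"
      using D[OF open_ball] by blast
    have "(w, z, q, n, p) \<in> I" using z p by (simp add: I_def)
    moreover have "x \<in> separation_set w z q n \<inter> ball p (norm z / Suc n / 2)"
      using z p by (simp add: dist_commute)
    ultimately show "x \<in> \<Union>(g ` I)" using g by fastforce
  qed
  moreover have "countable (g ` I)" "\<forall>G\<in>g ` I. lipschitz_graph G" using \<open>countable I\<close> g by auto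
  ultimately show ?thesis using jump_set_subset_singular_set by (meson order_trans)
qed

end
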